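(* Let $\lambda_1, \ldots, \lambda_k \in \mathbb{C}^\times$ be distinct, and $n_1, \ldots, n_k \in \mathbb{Z}_{\geq 1}$. Define $f=\prod_{i=1}^k (t-\lambda_i)^{n_i}$. Then a linear map $\mu: \langle f \rangle \rightarrow \mathbb{C}$ is a Lie algebra homomorphism if and only if there exist polynomials $p_1, \ldots, p_k$ with complex coefficients and $\deg(p_i) < n_i$ for each $i$ such that $\mu(t^j f) =p_1(j)\lambda_1^j+ \cdots + p_k(j) \lambda_k^j$ for all $j\in\mathbb{Z}$.
   Context: $\mathbb{C}[t^{\pm}]$ is regarded as a complex Lie algebra with bracket $[g,h]=t(gh'-hg')$, where $'$ is the usual derivative of Laurent polynomials and the products on the right are in the associative algebra $\mathbb{C}[t^{\pm}]$. For $f\in\mathbb{C}[t]$, $\langle f\rangle=\mathrm{span}_{\mathbb{C}}\{t^jf\mid j\in\mathbb{Z}\}$ is the associative ideal of $\mathbb{C}[t^{\pm}]$ generated by $f$; it is a Lie subalgebra of $\mathbb{C}[t^{\pm}]$. $\mathbb{C}$ is regarded as an abelian Lie algebra. The zero polynomial has degree $-1$. *)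

theory Defs
  imports
    Complex_Main
    "HOL-Library.Poly_Mapping"
    "HOL-Computational_Algebra.Polynomial"
begin

section \<open>Lie algebras\<close>

locale lie_algebra = vector_space scale
  for scale :: "'k::field \<Rightarrow> 'a::ab_group_add \<Rightarrow> 'a" +
  fixes bracket :: "'a \<Rightarrow> 'a \<Rightarrow> 'a"
  assumes bracket_add_left: "bracket (x + y) z = bracket x z + bracket y z"
    and bracket_add_right: "bracket x (y + z) = bracket x y + bracket x z"
    and bracket_scale_left: "bracket (scale c x) y = scale c (bracket x y)"
    and bracket_scale_right: "bracket x (scale c y) = scale c (bracket x y)"
    and bracket_self: "bracket x x = 0"
    and jacobi: "bracket x (bracket y z) + bracket y (bracket z x) + bracket z (bracket x y) = 0"
begin

definition lie_subalgebra :: "'a set \<Rightarrow> bool" where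
  "lie_subalgebra S \<longleftrightarrow> subspace S \<and> (\<forall>x\<in>S. \<forall>y\<in>S. bracket x y \<in> S)"

end

text \<open>A map whose domain is a proper subspace \<open>S\<close> is represented by a function on the whole type,
  of which only the values on \<open>S\<close> matter.\<close>

definition linear_on ::
  "('k::field \<Rightarrow> 'a::ab_group_add \<Rightarrow> 'a) \<Rightarrow> ('k \<Rightarrow> 'b::ab_group_add \<Rightarrow> 'b) \<Rightarrow>
    'a set \<Rightarrow> ('a \<Rightarrow> 'b) \<Rightarrow> bool" where
  "linear_on scale1 scale2 S \<mu> \<longleftrightarrow>
    (\<forall>x\<in>S. \<forall>y\<in>S. \<mu> (x + y) = \<mu> x + \<mu> y) \<and>
    (\<forall>c. \<forall>x\<in>S. \<mu> (scale1 c x) = scale2 c (\<mu> x))"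

definition lie_algebra_hom_on ::
  "('k::field \<Rightarrow> 'a::ab_group_add \<Rightarrow> 'a) \<Rightarrow> ('a \<Rightarrow> 'a \<Rightarrow> 'a) \<Rightarrow>
    ('k \<Rightarrow> 'b::ab_group_add \<Rightarrow> 'b) \<Rightarrow> ('b \<Rightarrow> 'b \<Rightarrow> 'b) \<Rightarrow>
    'a set \<Rightarrow> ('a \<Rightarrow> 'b) \<Rightarrow> bool" where
  "lie_algebra_hom_on scale1 bracket1 scale2 bracket2 S \<mu> \<longleftrightarrow>
    linear_on scale1 scale2 S \<mu> \<and>
    (\<forall>x\<in>S. \<forall>y\<in>S. \<mu> (bracket1 x y) = bracket2 (\<mu> x) (\<mu> y))"

definition abelian_bracket :: "'a::ab_group_add \<Rightarrow> 'a \<Rightarrow> 'a" where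
  "abelian_bracket x y = 0"

lemma lie_algebra_abelian_complex:
  "lie_algebra ((*) :: complex \<Rightarrow> complex \<Rightarrow> complex) abelian_bracket"
  by unfold_locales (simp_all add: abelian_bracket_def algebra_simps)


section \<open>Laurent polynomials\<close>

text \<open>Finitely supported functions on the integers with the convolution product, i.e. the group
  algebra of the integers.\<close>

type_synonym laurent = "int \<Rightarrow>\<^sub>0 complex"

definition laurent_scale :: "complex \<Rightarrow> laurent \<Rightarrow> laurent" where
  "laurent_scale c g = Poly_Mapping.map ((*) c) g"

definition laurent_t_pow :: "int \<Rightarrow> laurent" where
  "laurent_t_pow j = Poly_Mapping.single j 1"

definition laurent_of_poly :: "complex poly \<Rightarrow> laurent" where
  "laurent_of_poly p = (\<Sum>i\<le>degree p. laurent_scale (coeff p i) (laurent_t_pow (int i)))"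

lift_definition laurent_deriv :: "laurent \<Rightarrow> laurent" is
  "\<lambda>g n. of_int (n + 1) * g (n + 1)"
proof -
  fix g :: "int \<Rightarrow> complex"
  assume "finite {n. g n \<noteq> 0}"
  then have "finite ((\<lambda>n. n - 1) ` {n. g n \<noteq> 0})" by simp
  then show "finite {n. of_int (n + 1) * g (n + 1) \<noteq> 0}"
    by (rule rev_finite_subset) (force simp: image_iff)
qed

definition laurent_bracket :: "laurent \<Rightarrow> laurent \<Rightarrow> laurent" where
  "laurent_bracket g h = laurent_t_pow 1 * (g * laurent_deriv h - h * laurent_deriv g)"

lemma laurent_scale_conv_mult: "laurent_scale c g = Poly_Mapping.single 0 c * g"
  by (simp add: laurent_scale_def mult_map_scale_conv_mult)

lemma lookup_laurent_scale [simp]: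
  "Poly_Mapping.lookup (laurent_scale c g) n = c * Poly_Mapping.lookup g n"
  by (simp add: laurent_scale_def Poly_Mapping.map.rep_eq when_def)

lemma laurent_deriv_add: "laurent_deriv (g + h) = laurent_deriv g + laurent_deriv h"
  by (rule poly_mapping_eqI) (simp add: laurent_deriv.rep_eq lookup_add algebra_simps)

lemma laurent_deriv_diff: "laurent_deriv (g - h) = laurent_deriv g - laurent_deriv h"
  by (rule poly_mapping_eqI) (simp add: laurent_deriv.rep_eq lookup_minus algebra_simps)

lemma laurent_deriv_scale: "laurent_deriv (laurent_scale c g) = laurent_scale c (laurent_deriv g)"
  by (rule poly_mapping_eqI) (simp add: laurent_deriv.rep_eq)

lemma laurent_deriv_zero [simp]: "laurent_deriv 0 = 0"
  by (rule poly_mapping_eqI) (simp add: laurent_deriv.rep_eq)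

lemma laurent_deriv_single:
  "laurent_deriv (Poly_Mapping.single n c) = Poly_Mapping.single (n - 1) (of_int n * c)"
  by (rule poly_mapping_eqI) (auto simp: laurent_deriv.rep_eq lookup_single when_def)

lemma laurent_induct [case_names zero single add]:
  fixes g :: laurent
  assumes "P 0" and single: "\<And>n c. P (Poly_Mapping.single n c)"
    and add: "\<And>g h. P g \<Longrightarrow> P h \<Longrightarrow> P (g + h)"
  shows "P g"
proof (induction g rule: update_induct)
  case const
  show ?case using assms(1) .
next
  case (update f a b)
  have "Poly_Mapping.update a b f = f + Poly_Mapping.single a b"
    using update.hyps
    by (intro poly_mapping_eqI) (auto simp: lookup_update lookup_add lookup_single when_def in_keys_iff)
  then show ?case using add[OF update.IH single] by simp
qed

lemma laurent_deriv_mult: "laurent_deriv (g * h) = laurent_deriv g * h + g * laurent_deriv h"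
proof (induction g rule: laurent_induct)
  case (single m c)
  show ?case
  proof (induction h rule: laurent_induct)
    case (single n d)
    have "m - 1 + n = m + n - 1" "m + (n - 1) = m + n - 1" by simp_all
    moreover have "of_int (m + n) * (c * d) = of_int m * c * d + c * (of_int n * d)"
      by (simp add: algebra_simps)
    ultimately show ?case
      by (simp only: mult_single laurent_deriv_single single_add)
  qed (simp_all add: laurent_deriv_add algebra_simps)
qed (simp_all add: laurent_deriv_add algebra_simps)

interpretation laurent: lie_algebra laurent_scale laurent_bracket
proof
  fix a b :: complex and x y z :: laurent
  show "laurent_scale a (x + y) = laurent_scale a x + laurent_scale a y"
    by (simp add: laurent_scale_conv_mult algebra_simps)
  show "laurent_scale (a + b) x = laurent_scale a x + laurent_scale b x"
    by (simp add: laurent_scale_conv_mult single_add algebra_simps)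
  show "laurent_scale a (laurent_scale b x) = laurent_scale (a * b) x"
    by (rule poly_mapping_eqI) simp
  show "laurent_scale 1 x = x"
    by (rule poly_mapping_eqI) simp
  show "laurent_bracket (x + y) z = laurent_bracket x z + laurent_bracket y z"
    and "laurent_bracket x (y + z) = laurent_bracket x y + laurent_bracket x z"
    by (simp_all add: laurent_bracket_def laurent_deriv_add algebra_simps)
  show "laurent_bracket (laurent_scale a x) y = laurent_scale a (laurent_bracket x y)"
    and "laurent_bracket x (laurent_scale a y) = laurent_scale a (laurent_bracket x y)"
    by (simp_all add: laurent_bracket_def laurent_deriv_scale)
       (simp_all add: laurent_scale_conv_mult algebra_simps)
  show "laurent_bracket x x = 0"
    by (simp add: laurent_bracket_def)
  show "laurent_bracket x (laurent_bracket y z) + laurent_bracket y (laurent_bracket z x) +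
      laurent_bracket z (laurent_bracket x y) = 0"
    by (simp add: laurent_bracket_def laurent_deriv_mult laurent_deriv_diff algebra_simps)
qed

definition laurent_ideal :: "complex poly \<Rightarrow> laurent set" where
  "laurent_ideal f = laurent.span {laurent_t_pow j * laurent_of_poly f | j. True}"

lemma laurent_ideal_eq: "laurent_ideal f = {g * laurent_of_poly f | g. True}"
proof (rule set_eqI, rule iffI)
  fix x assume "x \<in> laurent_ideal f"
  then have "x \<in> laurent.span {laurent_t_pow j * laurent_of_poly f | j. True}"
    by (simp add: laurent_ideal_def)
  then show "x \<in> {g * laurent_of_poly f | g. True}"
  proof (induction rule: laurent.span_induct_alt)
    case base
    show ?case by (auto intro: exI[of _ 0])
  next
    case (step c x y)
    then obtain j g where "x = laurent_t_pow j * laurent_of_poly f" "y = g * laurent_of_poly f"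
      by blast
    then have "laurent_scale c x + y =
        (laurent_scale c (laurent_t_pow j) + g) * laurent_of_poly f"
      by (simp add: laurent_scale_conv_mult algebra_simps)
    then show ?case by blast
  qed
next
  fix x assume "x \<in> {g * laurent_of_poly f | g. True}"
  then obtain g where x: "x = g * laurent_of_poly f" by blast
  have "g * laurent_of_poly f \<in> laurent_ideal f"
  proof (induction g rule: laurent_induct)
    case zero
    show ?case by (simp add: laurent_ideal_def laurent.span_zero)
  next
    case (single n c)
    have "Poly_Mapping.single n c * laurent_of_poly f =
        laurent_scale c (laurent_t_pow n * laurent_of_poly f)"
      by (simp add: laurent_scale_conv_mult laurent_t_pow_def mult_single flip: mult.assoc)
    moreover have "laurent_t_pow n * laurent_of_poly f \<in> laurent_ideal f"
      unfolding laurent_ideal_def by (intro laurent.span_base) blast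
    ultimately show ?case
      by (simp add: laurent_ideal_def laurent.span_scale)
  next
    case (add g h)
    then show ?case by (simp add: laurent_ideal_def distrib_right laurent.span_add)
  qed
  then show "x \<in> laurent_ideal f" by (simp add: x)
qed

lemma lie_subalgebra_laurent_ideal: "laurent.lie_subalgebra (laurent_ideal f)"
  unfolding laurent.lie_subalgebra_def
proof (intro conjI ballI)
  show "laurent.subspace (laurent_ideal f)"
    by (simp add: laurent_ideal_def)
  fix x y assume "x \<in> laurent_ideal f" "y \<in> laurent_ideal f"
  then obtain g h where "x = g * laurent_of_poly f" "y = h * laurent_of_poly f"
    by (auto simp: laurent_ideal_eq)
  then have "laurent_bracket x y = (laurent_t_pow 1 *
      (g * laurent_deriv y - h * laurent_deriv x)) * laurent_of_poly f"
    by (simp add: laurent_bracket_def algebra_simps)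
  then show "laurent_bracket x y \<in> laurent_ideal f"
    unfolding laurent_ideal_eq by blast
qed

end

theory Submission
  imports
    Defs
    "HOL-Computational_Algebra.Field_as_Ring"
    "HOL-Computational_Algebra.Polynomial_Factorial"
begin

text \<open>Since \<open>[g f, h f] = t (g h' - h g') f\<^sup>2\<close>, the map \<open>\<mu>\<close> is a homomorphism iff it kills
  every \<open>t\<^sup>m f\<^sup>2\<close>, i.e. iff the two-sided sequence \<open>a j = \<mu> (t\<^sup>j f)\<close> is annihilated by \<open>f(S)\<close>, where
  \<open>S\<close> is the shift. By Bezout, the kernel of \<open>f(S)\<close> is the sum of the kernels of the
  \<open>(S - \<lambda>\<^sub>i) ^ n\<^sub>i\<close>. Dividing a sequence by \<open>\<lambda>\<^sub>i\<^sup>j\<close> turns such an operator into a multiple of a power of the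
  forward difference operator, whose kernel consists of polynomials by Newton's expansion in
  binomial coefficients.\<close>

section \<open>Polynomials in the shift operator\<close>

text \<open>The sum runs along the coefficients as in \<open>laurent_of_poly\<close>, which lets the
  two be compared termwise.\<close>

definition shift_poly :: "complex poly \<Rightarrow> (int \<Rightarrow> complex) \<Rightarrow> int \<Rightarrow> complex" where
  "shift_poly p a j = (\<Sum>i\<le>degree p. coeff p i * a (j + int i))"

lemma shift_poly_0 [simp]: "shift_poly 0 a j = 0"
  by (simp add: shift_poly_def)

lemma shift_poly_pCons [simp]:
  "shift_poly (pCons c p) a j = c * a j + shift_poly p a (j + 1)"
proof (cases "p = 0")
  case False
  then show ?thesis
    by (simp add: shift_poly_def sum.atMost_Suc_shift add.assoc del: sum.atMost_Suc)
qed (simp add: shift_poly_def)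

lemma shift_poly_1 [simp]: "shift_poly 1 a = a"
  by (auto simp: shift_poly_def)

lemma shift_poly_add: "shift_poly (p + q) a j = shift_poly p a j + shift_poly q a j"
  by (induction p q arbitrary: j rule: poly_induct2) (simp_all add: algebra_simps)

lemma shift_poly_smult: "shift_poly (smult c p) a j = c * shift_poly p a j"
  by (induction p arbitrary: j) (simp_all add: algebra_simps)

text \<open>Evaluation at the shift is multiplicative, so factors of a polynomial act one after the
  other, in any order.\<close>

lemma shift_poly_mult: "shift_poly (p * q) a j = shift_poly p (shift_poly q a) j"
  by (induction p arbitrary: j) (simp_all add: shift_poly_add shift_poly_smult)

lemma shift_poly_add_seq:
  "shift_poly p (\<lambda>j. a j + b j) j = shift_poly p a j + shift_poly p b j"
  by (simp add: shift_poly_def algebra_simps sum.distrib)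

lemma shift_poly_zero_seq [simp]: "shift_poly p (\<lambda>j. 0) j = 0"
  by (simp add: shift_poly_def)

lemma shift_poly_mult_zero:
  assumes "\<And>j. shift_poly q a j = 0"
  shows "shift_poly (p * q) a j = 0"
proof -
  have "shift_poly q a = (\<lambda>j. 0)" using assms by auto
  then show ?thesis by (simp add: shift_poly_mult)
qed

section \<open>The kernel of a power of a linear factor\<close>

text \<open>Substituting x + 1 keeps degree and leading coefficient, so the top terms cancel. The
  second alternative covers constants: \<open>degree 0 = 0\<close> is not below
  \<open>m = 0\<close>.\<close>

lemma degree_forward_difference_less:
  fixes p :: "complex poly"
  assumes "degree p < Suc m"
  shows "degree (pcompose p [:1, 1:] - p) < m \<or> pcompose p [:1, 1:] - p = 0"
proof (cases "degree p = 0")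
  case True
  then obtain c where "p = [:c:]" by (rule degree_eq_zeroE)
  then show ?thesis by simp
next
  case False
  let ?q = "pcompose p [:1, 1:]"
  have deg: "degree ?q = degree p" by (simp add: degree_pcompose)
  have lc: "lead_coeff ?q = lead_coeff p" by (subst lead_coeff_comp) simp_all
  show ?thesis
  proof (cases "?q - p = 0")
    case False
    have "degree (?q - p) \<le> degree p" using deg by (intro degree_diff_le) auto
    moreover have "coeff (?q - p) (degree p) = 0" using lc deg by simp
    ultimately have "degree (?q - p) < degree p"
      using False by (metis le_neq_implies_less leading_coeff_0_iff)
    then show ?thesis using assms by simp
  qed simp
qed

text \<open>One linear factor turns \<open>p\<close> into \<open>c\<close> times its forward
  difference, which lowers the degree; \<open>m\<close> factors leave nothing.\<close>

lemma shift_poly_power_linear_exponential_poly: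
  assumes "degree p < m" and "c \<noteq> 0"
  shows "shift_poly ([:- c, 1:] ^ m) (\<lambda>j. poly p (of_int j) * c powi j) j = 0"
  using assms(1)
proof (induction m arbitrary: p j)
  case (Suc m)
  define q where "q = smult c (pcompose p [:1, 1:] - p)"
  have eq: "shift_poly [:- c, 1:] (\<lambda>j. poly p (of_int j) * c powi j) =
      (\<lambda>j. poly q (of_int j) * c powi j)"
    using assms(2) by (auto simp: q_def poly_pcompose power_int_add algebra_simps)
  have "degree q < m \<or> q = 0"
    using degree_forward_difference_less[OF Suc.prems] assms(2) by (auto simp: q_def)
  then have "shift_poly ([:- c, 1:] ^ m) (\<lambda>j. poly q (of_int j) * c powi j) j = 0"
    using Suc.IH by auto
  \<comment> \<open>\<open>power_Suc2\<close> splits the linear factor off on the right, so that it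
    acts on the sequence first.\<close>
  then show ?case
    by (simp only: power_Suc2 shift_poly_mult eq)
qed simp

lemma constant_if_forward_difference_zero:
  fixes d :: "int \<Rightarrow> complex"
  assumes "\<And>j. d (j + 1) = d j"
  shows "d j = d 0"
proof (induction j rule: int_induct[where k = 0])
  case (step2 i)
  then show ?case using assms[of "i - 1"] by simp
qed (simp_all add: assms)

text \<open>Pascal's rule: the next binomial coefficient is a discrete antiderivative.\<close>

lemma gbinomial_forward_difference:
  "(of_int (j + 1) gchoose Suc l) - (of_int j gchoose Suc l) = (of_int j gchoose l :: complex)"
  by (simp add: gbinomial_Suc_Suc)

lemma kernel_shift_poly_power_linear:
  assumes "\<And>j. shift_poly ([:- c, 1:] ^ m) a j = 0" and c: "c \<noteq> 0"
  shows "\<exists>e. \<forall>j. a j = (\<Sum>l<m. e l * (of_int j gchoose l)) * c powi j"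
  using assms(1)
proof (induction m arbitrary: a)
  case (Suc m)
  have "shift_poly ([:- c, 1:] ^ m) (shift_poly [:- c, 1:] a) j = 0" for j
    using Suc.prems[of j] by (simp only: power_Suc2 shift_poly_mult)
  from Suc.IH[OF this] obtain e where
    e: "\<And>j. shift_poly [:- c, 1:] a j = (\<Sum>l<m. e l * (of_int j gchoose l)) * c powi j"
    by blast
  \<comment> \<open>What remains of \<open>a j / c powi j\<close> after subtracting an
    antiderivative of its difference. The division by \<open>c\<close> arises because S - c maps
    \<open>b j * c powi j\<close> to \<open>c powi (j + 1)\<close> times the difference of
    \<open>b\<close>.\<close>
  define d where "d j = a j / c powi j - (\<Sum>l<m. e l / c * (of_int j gchoose Suc l))" for j
  have "d (j + 1) = d j" for j
  proof -
    have "a (j + 1) = c * a j + (\<Sum>l<m. e l * (of_int j gchoose l)) * c powi j"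
      using e[of j] by (simp add: algebra_simps)
    then have "a (j + 1) / c powi (j + 1) - a j / c powi j =
        (\<Sum>l<m. e l * (of_int j gchoose l)) / c"
      using c by (simp add: power_int_add field_simps)
    also have "\<dots> = (\<Sum>l<m. e l / c * ((of_int (j + 1) gchoose Suc l) - (of_int j gchoose Suc l)))"
      by (simp only: gbinomial_forward_difference sum_divide_distrib times_divide_eq_left)
    finally show ?thesis
      by (simp only: d_def right_diff_distrib sum_subtractf) (simp add: algebra_simps)
  qed
  then have "d j = d 0" for j by (rule constant_if_forward_difference_zero)
  then have "a j / c powi j = d 0 + (\<Sum>l<m. e l / c * (of_int j gchoose Suc l))" for j
    by (metis d_def diff_add_cancel)
  then have "a j = (d 0 + (\<Sum>l<m. e l / c * (of_int j gchoose Suc l))) * c powi j" for j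
    using c by (metis nonzero_divide_eq_eq power_int_not_zero)
  \<comment> \<open>The constant of summation \<open>d 0\<close> becomes the coefficient at index 0;
    the others move up by one.\<close>
  then have "\<forall>j. a j =
      (\<Sum>l<Suc m. (case l of 0 \<Rightarrow> d 0 | Suc l \<Rightarrow> e l / c) * (of_int j gchoose l)) * c powi j"
    by (simp add: sum.lessThan_Suc_shift del: sum.lessThan_Suc)
  then show ?case by blast
qed simp

text \<open>\<open>x gchoose l\<close> is a product of \<open>l\<close> linear factors over
  \<open>fact l\<close>. The bound on \<open>m\<close> is there because
  \<open>degree 0 = 0\<close>.\<close>

lemma gbinomial_sum_eq_poly:
  fixes e :: "nat \<Rightarrow> complex"
  assumes "m \<ge> 1"
  obtains p where "degree p < m" and "\<And>x. poly p x = (\<Sum>l<m. e l * (x gchoose l))"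
proof
  define p where
    "p = (\<Sum>l<m. smult (e l / fact l) (\<Prod>i = 0..<l. [:- of_nat i, 1:]))"
  show "degree p < m"
    unfolding p_def
  proof (rule degree_sum_less)
    fix l assume "l \<in> {..<m}"
    moreover have "degree (\<Prod>i = 0..<l. [:- of_nat i, 1 :: complex:]) \<le> l"
      using degree_prod_sum_le[of "{0..<l}" "\<lambda>i. [:- of_nat i, 1 :: complex:]"] by simp
    ultimately show "degree (smult (e l / fact l) (\<Prod>i = 0..<l. [:- of_nat i, 1:])) < m"
      using degree_smult_le le_less_trans by (metis lessThan_iff)
  qed (use assms in simp)
  show "poly p x = (\<Sum>l<m. e l * (x gchoose l))" for x
    by (simp add: p_def poly_sum poly_prod gbinomial_prod_rev)
qed

section \<open>The kernel of a product of powers of linear factors\<close>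

lemma coprime_linear:
  fixes c d :: complex
  assumes "c \<noteq> d"
  shows "coprime [:- c, 1:] [:- d, 1:]"
proof (rule coprimeI)
  fix q assume "q dvd [:- c, 1:]" "q dvd [:- d, 1:]"
  then have "q dvd [:- c, 1:] - [:- d, 1:]" by (rule dvd_diff)
  then have "q dvd [:d - c:]" by simp
  moreover have "is_unit [:d - c:]" using assms by (intro is_unit_triv) simp
  ultimately show "is_unit q" by (rule dvd_trans)
qed

text \<open>Let \<open>u * p + v * q = 1\<close>. The part of \<open>a\<close> produced by
  \<open>v * q\<close> is killed by \<open>p\<close>, as \<open>p * (v * q)\<close> is a multiple of
  \<open>p * q\<close>; the other part is symmetric.\<close>

lemma kernel_shift_poly_mult_coprime:
  assumes "coprime p q" and "\<And>j. shift_poly (p * q) a j = 0"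
  obtains b c where "\<And>j. a j = b j + c j"
    and "\<And>j. shift_poly p b j = 0" and "\<And>j. shift_poly q c j = 0"
proof -
  obtain u v where uv: "u * p + v * q = 1"
    using bezout_coefficients_fst_snd[of p q] assms(1) coprime_iff_gcd_eq_1 by metis
  show ?thesis
  proof
    show "a j = shift_poly (v * q) a j + shift_poly (u * p) a j" for j
      using uv by (metis add.commute shift_poly_1 shift_poly_add)
    show "shift_poly p (shift_poly (v * q) a) j = 0" for j
      using shift_poly_mult_zero[of "p * q" a v j, OF assms(2)]
      by (simp add: mult_ac flip: shift_poly_mult)
    show "shift_poly q (shift_poly (u * p) a) j = 0" for j
      using shift_poly_mult_zero[of "p * q" a u j, OF assms(2)]
      by (simp add: mult_ac flip: shift_poly_mult)
  qed
qed

text \<open>Induction splits off one root at a time. As \<open>n i \<ge> 1\<close>, the convention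
  \<open>degree 0 = 0\<close> admits the zero polynomial just as degree -1 would.\<close>

lemma kernel_shift_poly_prod:
  fixes lam :: "'i \<Rightarrow> complex"
  assumes "finite I" and "\<And>i. i \<in> I \<Longrightarrow> lam i \<noteq> 0" and "inj_on lam I"
    and "\<And>i. i \<in> I \<Longrightarrow> n i \<ge> 1"
  shows "(\<forall>j. shift_poly (\<Prod>i\<in>I. [:- lam i, 1:] ^ n i) a j = 0) \<longleftrightarrow>
    (\<exists>p. (\<forall>i\<in>I. degree (p i) < n i) \<and>
      (\<forall>j. a j = (\<Sum>i\<in>I. poly (p i) (of_int j) * lam i powi j)))"
  using assms
proof (induction I arbitrary: a rule: finite_induct)
  case empty
  then show ?case by simp
next
  case (insert x I)
  let ?P = "[:- lam x, 1:] ^ n x" and ?Q = "\<Prod>i\<in>I. [:- lam i, 1:] ^ n i"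
  have IH: "(\<forall>j. shift_poly ?Q b j = 0) \<longleftrightarrow> (\<exists>p. (\<forall>i\<in>I. degree (p i) < n i) \<and>
      (\<forall>j. b j = (\<Sum>i\<in>I. poly (p i) (of_int j) * lam i powi j)))" for b
    using insert.prems by (intro insert.IH) auto
  have prod: "(\<Prod>i\<in>insert x I. [:- lam i, 1:] ^ n i) = ?P * ?Q"
    using insert.hyps by simp
  have "lam x \<noteq> 0" "n x \<ge> 1" using insert.prems by auto
  show ?case
    unfolding prod
  proof
    assume a: "\<forall>j. shift_poly (?P * ?Q) a j = 0"
    have "lam x \<noteq> lam i" if "i \<in> I" for i
      using that insert by (auto simp: inj_on_def)
    then have "coprime ?P ?Q"
      by (intro prod_coprime_right) (auto intro: coprime_linear)
    then obtain b c where abc: "\<And>j. a j = b j + c j"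
        and b: "\<And>j. shift_poly ?P b j = 0" and c: "\<And>j. shift_poly ?Q c j = 0"
      using kernel_shift_poly_mult_coprime[of ?P ?Q a] a by blast
    obtain e where e: "\<And>j. b j = (\<Sum>l<n x. e l * (of_int j gchoose l)) * lam x powi j"
      using kernel_shift_poly_power_linear[OF b \<open>lam x \<noteq> 0\<close>] by blast
    obtain q where q: "degree q < n x" "\<And>z. poly q z = (\<Sum>l<n x. e l * (z gchoose l))"
      using gbinomial_sum_eq_poly[OF \<open>n x \<ge> 1\<close>, of e] by blast
    obtain p where p: "\<forall>i\<in>I. degree (p i) < n i"
        "\<And>j. c j = (\<Sum>i\<in>I. poly (p i) (of_int j) * lam i powi j)"
      using IH[of c] c by blast
    have sum: "(\<Sum>i\<in>I. poly ((p(x := q)) i) (of_int j) * lam i powi j) = c j" for j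
      unfolding p(2) using insert.hyps(2) by (intro sum.cong) auto
    show "\<exists>p. (\<forall>i\<in>insert x I. degree (p i) < n i) \<and>
        (\<forall>j. a j = (\<Sum>i\<in>insert x I. poly (p i) (of_int j) * lam i powi j))"
      by (rule exI[of _ "p(x := q)"])
         (use insert.hyps p(1) q sum in \<open>simp add: abc e\<close>)
  next
    assume "\<exists>p. (\<forall>i\<in>insert x I. degree (p i) < n i) \<and>
        (\<forall>j. a j = (\<Sum>i\<in>insert x I. poly (p i) (of_int j) * lam i powi j))"
    then obtain p where deg: "\<forall>i\<in>insert x I. degree (p i) < n i"
        and a: "\<And>j. a j = (\<Sum>i\<in>insert x I. poly (p i) (of_int j) * lam i powi j)"
      by blast
    define b c where "b j = poly (p x) (of_int j) * lam x powi j"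
      and "c j = (\<Sum>i\<in>I. poly (p i) (of_int j) * lam i powi j)" for j
    have abc: "a = (\<lambda>j. b j + c j)"
      using insert.hyps by (auto simp: a b_def c_def)
    have "shift_poly ?P b j = 0" for j
      unfolding b_def using deg \<open>lam x \<noteq> 0\<close>
      by (intro shift_poly_power_linear_exponential_poly) auto
    moreover have "\<forall>j. shift_poly ?Q c j = 0"
      unfolding IH using deg by (auto simp: c_def)
    \<comment> \<open>Each component is killed by one of two commuting factors, hence by their
      product.\<close>
    ultimately show "\<forall>j. shift_poly (?P * ?Q) a j = 0"
      using shift_poly_mult_zero[of ?P b ?Q] shift_poly_mult_zero[of ?Q c ?P]
      by (simp add: abc shift_poly_add_seq mult.commute)
  qed
qed

section \<open>Functionals on the ideal\<close>

lemma linear_on_sum: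
  assumes "linear_on laurent_scale (*) (laurent_ideal f) \<mu>"
    and "finite A" and "\<And>i. i \<in> A \<Longrightarrow> g i \<in> laurent_ideal f"
  shows "\<mu> (\<Sum>i\<in>A. g i) = (\<Sum>i\<in>A. \<mu> (g i))"
  using assms(2,3)
proof (induction A rule: finite_induct)
  case empty
  have "0 \<in> laurent_ideal f" by (simp add: laurent_ideal_def laurent.span_zero)
  then have "\<mu> (0 + 0) = \<mu> 0 + \<mu> 0"
    using assms(1) unfolding linear_on_def by blast
  then show ?case by simp
next
  case (insert i A)
  have "(\<Sum>i\<in>A. g i) \<in> laurent_ideal f"
    using insert.prems by (auto simp: laurent_ideal_def intro: laurent.span_sum)
  then show ?case
    using insert assms(1) unfolding linear_on_def by simp
qed

lemma mult_laurent_of_poly_in_ideal: "g * laurent_of_poly f \<in> laurent_ideal f"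
  unfolding laurent_ideal_eq by blast

text \<open>Expanding only one of the two factors \<open>f\<close> in powers of t leaves a
  combination of the \<open>t\<^sup>j f\<close>, on which \<open>\<mu>\<close> is linear.\<close>

lemma functional_t_pow_mult_square:
  assumes "linear_on laurent_scale (*) (laurent_ideal f) \<mu>"
  shows "\<mu> (laurent_t_pow m * laurent_of_poly f * laurent_of_poly f) =
    shift_poly f (\<lambda>j. \<mu> (laurent_t_pow j * laurent_of_poly f)) m"
proof -
  have "laurent_t_pow m * laurent_of_poly f =
      (\<Sum>i\<le>degree f. laurent_scale (coeff f i) (laurent_t_pow (m + int i)))"
    unfolding laurent_of_poly_def sum_distrib_left
    by (simp add: laurent_scale_conv_mult laurent_t_pow_def mult_single)
  then have "\<mu> (laurent_t_pow m * laurent_of_poly f * laurent_of_poly f) =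
      \<mu> (\<Sum>i\<le>degree f. laurent_scale (coeff f i) (laurent_t_pow (m + int i)) * laurent_of_poly f)"
    by (simp add: sum_distrib_right)
  also have "\<dots> =
      (\<Sum>i\<le>degree f. \<mu> (laurent_scale (coeff f i) (laurent_t_pow (m + int i)) * laurent_of_poly f))"
    using assms by (rule linear_on_sum) (simp_all add: mult_laurent_of_poly_in_ideal)
  also have "\<dots> = (\<Sum>i\<le>degree f. coeff f i * \<mu> (laurent_t_pow (m + int i) * laurent_of_poly f))"
    using assms mult_laurent_of_poly_in_ideal unfolding linear_on_def
    by (simp add: laurent_scale_conv_mult mult.assoc)
  finally show ?thesis by (simp add: shift_poly_def)
qed

text \<open>Passes from a spanning set to the whole ideal generated by \<open>f\<^sup>2\<close>,
  where all brackets lie.\<close>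

lemma functional_mult_square_zero:
  assumes "linear_on laurent_scale (*) (laurent_ideal f) \<mu>"
    and "\<And>m. \<mu> (laurent_t_pow m * laurent_of_poly f * laurent_of_poly f) = 0"
  shows "\<mu> (w * laurent_of_poly f * laurent_of_poly f) = 0"
proof (induction w rule: laurent_induct)
  case zero
  show ?case using linear_on_sum[OF assms(1), of "{}"] by simp
next
  case (single m c)
  have "Poly_Mapping.single m c * laurent_of_poly f * laurent_of_poly f =
      laurent_scale c (laurent_t_pow m * laurent_of_poly f * laurent_of_poly f)"
    by (simp add: laurent_scale_conv_mult laurent_t_pow_def mult_single flip: mult.assoc)
  then show ?case
    using assms mult_laurent_of_poly_in_ideal unfolding linear_on_def by simp
next
  case (add g h)
  then show ?case
    using assms(1) mult_laurent_of_poly_in_ideal unfolding linear_on_def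
    by (simp add: distrib_right)
qed

text \<open>By the Leibniz rule, the terms with the derivative of \<open>F\<close> are symmetric in
  \<open>g\<close> and \<open>h\<close> and cancel.\<close>

lemma laurent_bracket_mult_common:
  "laurent_bracket (g * F) (h * F) = laurent_bracket g h * F * F"
  by (simp add: laurent_bracket_def laurent_deriv_mult algebra_simps)

text \<open>The Witt algebra relations. Every integer is a sum of two distinct ones, so each power
  of t is a multiple of a bracket.\<close>

lemma laurent_bracket_t_pow:
  "laurent_bracket (laurent_t_pow i) (laurent_t_pow j) =
    laurent_scale (of_int (j - i)) (laurent_t_pow (i + j))"
  by (simp add: laurent_bracket_def laurent_t_pow_def laurent_deriv_single mult_single
      laurent_scale_conv_mult algebra_simps flip: single_diff)

lemma lie_algebra_hom_on_ideal_iff: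
  assumes lin: "linear_on laurent_scale (*) (laurent_ideal f) \<mu>"
  shows "lie_algebra_hom_on laurent_scale laurent_bracket (*) abelian_bracket (laurent_ideal f) \<mu> \<longleftrightarrow>
    (\<forall>m. \<mu> (laurent_t_pow m * laurent_of_poly f * laurent_of_poly f) = 0)"
    (is "?hom \<longleftrightarrow> _")
proof
  let ?F = "laurent_of_poly f"
  assume ?hom
  show "\<forall>m. \<mu> (laurent_t_pow m * ?F * ?F) = 0"
  proof
    fix m :: int
    \<comment> \<open>any \<open>i\<close> with \<open>m \<noteq> 2 * i\<close> would do\<close>
    define i where "i = \<bar>m\<bar> + 1"
    define c :: complex where "c = of_int (m - i - i)"
    have "m - i - i \<noteq> 0" by (simp add: i_def)
    then have "c \<noteq> 0" by (simp only: c_def of_int_eq_0_iff not_False_eq_True)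
    have "laurent_bracket (laurent_t_pow i * ?F) (laurent_t_pow (m - i) * ?F) =
        laurent_scale c (laurent_t_pow m * ?F * ?F)"
      by (simp add: laurent_bracket_mult_common laurent_bracket_t_pow c_def
          laurent_scale_conv_mult mult.assoc)
    moreover have "\<mu> (laurent_bracket (laurent_t_pow i * ?F) (laurent_t_pow (m - i) * ?F)) = 0"
      using \<open>?hom\<close> mult_laurent_of_poly_in_ideal
      unfolding lie_algebra_hom_on_def abelian_bracket_def by blast
    moreover have "\<mu> (laurent_scale c (laurent_t_pow m * ?F * ?F)) =
        c * \<mu> (laurent_t_pow m * ?F * ?F)"
      using lin mult_laurent_of_poly_in_ideal unfolding linear_on_def by blast
    ultimately show "\<mu> (laurent_t_pow m * ?F * ?F) = 0" using \<open>c \<noteq> 0\<close> by simp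
  qed
next
  assume "\<forall>m. \<mu> (laurent_t_pow m * laurent_of_poly f * laurent_of_poly f) = 0"
  then have "\<mu> (w * laurent_of_poly f * laurent_of_poly f) = 0" for w
    using functional_mult_square_zero[OF lin] by blast
  then show ?hom
    using lin unfolding lie_algebra_hom_on_def abelian_bracket_def laurent_ideal_eq
    by (auto simp: laurent_bracket_mult_common)
qed

theorem lemma3p2:
  fixes k :: nat and lam :: "nat \<Rightarrow> complex" and n :: "nat \<Rightarrow> nat"
    and f :: "complex poly" and \<mu> :: "laurent \<Rightarrow> complex"
  assumes "\<And>i. i \<in> {1..k} \<Longrightarrow> lam i \<noteq> 0"
    and "inj_on lam {1..k}"
    and "\<And>i. i \<in> {1..k} \<Longrightarrow> n i \<ge> 1"
    and "f = (\<Prod>i=1..k. [:- lam i, 1:] ^ n i)"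
    and "linear_on laurent_scale (*) (laurent_ideal f) \<mu>"
  shows "lie_algebra_hom_on laurent_scale laurent_bracket (*) abelian_bracket (laurent_ideal f) \<mu> \<longleftrightarrow>
    (\<exists>p :: nat \<Rightarrow> complex poly.
      (\<forall>i\<in>{1..k}. degree (p i) < n i) \<and>
      (\<forall>j :: int. \<mu> (laurent_t_pow j * laurent_of_poly f) =
        (\<Sum>i=1..k. poly (p i) (of_int j) * lam i powi j)))"
  unfolding lie_algebra_hom_on_ideal_iff[OF assms(5)] functional_t_pow_mult_square[OF assms(5)]
  \<comment> \<open>Only the \<open>f\<close> acting as operator is expanded into the product; the
    one inside the sequence stays.\<close>
  by (subst (1) assms(4)) (rule kernel_shift_poly_prod[OF finite_atLeastAtMost assms(1-3)])

end
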